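(* Let $n \ge 1$. For a set $V = \{w_0,\dots,w_n\} \subset \mathbf{R}^n$ of $n+1$ distinct unit vectors, let $\mathrm{D}(V) = \min\{|\det(w_{j_1},\dots,w_{j_n})| : 0 \le j_1 < \dots < j_n \le n\}$. Then, among all sets $V$ of $n+1$ distinct unit vectors in $\mathbf{R}^n$, $\mathrm{D}(V)$ is maximized when $w_0,\dots,w_n$ are the vertices of a regular simplex, and in that case $$\mathrm{D}(V) = \sqrt{\frac{(n+1)^{n-1}}{n^n}}.$$ That is, every set $V$ of $n+1$ distinct unit vectors in $\mathbf{R}^n$ satisfies $\mathrm{D}(V) \le \sqrt{(n+1)^{n-1}/n^n}$, with equality whenever $V$ is the vertex set of a regular simplex.
   Context: Unit vectors are taken with respect to the standard Euclidean norm on $\mathbf{R}^n$, and $\det(w_{j_1},\dots,w_{j_n})$ is the determinant of the $n\times n$ matrix with columns $w_{j_1},\dots,w_{j_n}$. A regular simplex in $\mathbf{R}^n$ with vertices $p_0,\dots,p_n$ is the convex hull of $n+1$ affinely independent points all of whose pairwise distances are equal. *)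

theory Defs
  imports "HOL-Analysis.Analysis"
begin

text \<open>
  The injective maps \<open>w\<close> from the index type into \<open>V\<close> are the choices of \<open>n\<close> distinct vectors of
  \<open>V\<close> as columns, in any order. As the order of the columns only affects the sign of the
  determinant, this is the minimum over increasing selections of indices for any enumeration of
  \<open>V\<close>; see \<open>min_abs_det_enumerate\<close> below.
\<close>

definition min_abs_det :: "(real ^ 'n) set \<Rightarrow> real"
  where "min_abs_det V =
    Min {\<bar>det (\<chi> i k. w k $ i)\<bar> | w :: 'n \<Rightarrow> real ^ 'n. inj w \<and> range w \<subseteq> V}"

definition regular_simplex_with_vertices :: "(real ^ 'n) set \<Rightarrow> (real ^ 'n) set \<Rightarrow> bool"
  where "regular_simplex_with_vertices S P \<longleftrightarrow>
    card P = CARD('n) + 1 \<and> \<not> affine_dependent P \<and>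
    (\<exists>d. \<forall>p\<in>P. \<forall>q\<in>P. p \<noteq> q \<longrightarrow> dist p q = d) \<and>
    S = convex hull P"

text \<open>
  The map \<open>e\<close> is an arbitrary numbering of the coordinates, which only fixes in which order the
  columns are written.
\<close>

lemma min_abs_det_enumerate:
  fixes w :: "nat \<Rightarrow> real ^ 'n" and e :: "'n \<Rightarrow> nat"
  assumes w: "inj_on w {0..CARD('n)}"
    and e: "bij_betw e UNIV {0..<CARD('n)}"
  shows "min_abs_det (w ` {0..CARD('n)}) =
    Min {\<bar>det (\<chi> i k. w (j (e k)) $ i)\<bar> | j.
      strict_mono_on {0..<CARD('n)} j \<and> j ` {0..<CARD('n)} \<subseteq> {0..CARD('n)}}"
proof -
  let ?n = "CARD('n)"
  have "{\<bar>det (\<chi> i k. f k $ i)\<bar> | f :: 'n \<Rightarrow> real ^ 'n. inj f \<and> range f \<subseteq> w ` {0..?n}} =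
    {\<bar>det (\<chi> i k. w (j (e k)) $ i)\<bar> | j.
      strict_mono_on {0..<?n} j \<and> j ` {0..<?n} \<subseteq> {0..?n}}" (is "?A = ?B")
  proof (intro equalityI subsetI)
    fix x assume "x \<in> ?A"
    then obtain f :: "'n \<Rightarrow> real ^ 'n" where f: "inj f" "range f \<subseteq> w ` {0..?n}"
      and x: "x = \<bar>det (\<chi> i k. f k $ i)\<bar>" by auto
    define g where "g = inv_into {0..?n} w \<circ> f"
    have wg: "w (g k) = f k" and g_in: "g k \<in> {0..?n}" for k
    proof -
      have "f k \<in> w ` {0..?n}" using f(2) by blast
      then show "w (g k) = f k" "g k \<in> {0..?n}"
        unfolding g_def comp_def by (simp_all only: f_inv_into_f inv_into_into)
    qed
    have inj_g: "inj g"
      by (rule injI) (metis wg f(1) injD)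
    define J where "J = range g"
    have J: "finite J" "card J = ?n" "J \<subseteq> {0..?n}"
      using g_in inj_g by (auto simp: J_def card_image)
    define j where "j = (\<lambda>k. sorted_list_of_set J ! k)"
    have mono: "strict_mono_on {0..<?n} j"
      unfolding j_def strict_mono_on_def
      using J sorted_wrt_nth_less[OF strict_sorted_list_of_set, of _ _ J] by auto
    have bij_j: "bij_betw j {0..<?n} J"
      unfolding j_def using J
      by (intro bij_betw_nth) (auto simp: atLeast0LessThan)
    have bij_je: "bij_betw (j \<circ> e) UNIV J"
      by (rule bij_betw_trans[OF e bij_j])
    define p where "p = inv (j \<circ> e) \<circ> g"
    have jep: "j (e (p k)) = g k" for k
    proof -
      have "g k \<in> range (j \<circ> e)"
        using bij_je by (auto simp: J_def bij_betw_def)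
      then have "(j \<circ> e) (inv (j \<circ> e) (g k)) = g k"
        by (rule f_inv_into_f)
      then show ?thesis by (simp add: p_def)
    qed
    have "inj p"
      by (rule injI) (metis jep inj_g injD)
    then have p: "p permutes UNIV"
      by (metis bij_imp_permutes finite_UNIV_inj_surj finite bijI UNIV_I)
    have "det (\<chi> i k. f k $ i) = det (\<chi> i k. (\<chi> i k. w (j (e k)) $ i) $ i $ p k)"
      by (simp add: jep wg)
    also have "\<dots> = of_int (sign p) * det (\<chi> i k. w (j (e k)) $ i)"
      by (rule det_permute_columns[OF p])
    finally have "x = \<bar>det (\<chi> i k. w (j (e k)) $ i)\<bar>"
      by (simp add: x abs_mult sign_def)
    moreover have "j ` {0..<?n} \<subseteq> {0..?n}"
      using bij_j J(3) by (simp add: bij_betw_def)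
    ultimately show "x \<in> ?B" using mono by blast
  next
    fix x assume "x \<in> ?B"
    then obtain j where j: "strict_mono_on {0..<?n} j" "j ` {0..<?n} \<subseteq> {0..?n}"
      and x: "x = \<bar>det (\<chi> i k. w (j (e k)) $ i)\<bar>" by auto
    have e': "inj e" "range e = {0..<?n}"
      using e by (auto simp: bij_betw_def)
    have "inj (j \<circ> e)"
      using e' strict_mono_on_imp_inj_on[OF j(1)] by (simp add: comp_inj_on)
    moreover have r: "range (j \<circ> e) \<subseteq> {0..?n}"
      using e' j(2) by (metis image_comp)
    ultimately have "inj (w \<circ> (j \<circ> e))"
      by (rule comp_inj_on[OF _ inj_on_subset[OF w]])
    moreover have "range (w \<circ> (j \<circ> e)) \<subseteq> w ` {0..?n}"
      using r by auto
    ultimately show "x \<in> ?A"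
      using x by (intro CollectI exI[of _ "w \<circ> (j \<circ> e)"]) auto
  qed
  then show ?thesis by (simp only: min_abs_det_def)
qed

end

theory Submission
  imports Defs
begin

text \<open>
  Let \<open>W\<close> be the matrix with columns \<open>w\<^sub>0, \<dots>, w\<^sub>n\<close>. By Cauchy--Binet the sum of the squares of
  the \<open>n + 1\<close> maximal minors of \<open>W\<close> is \<open>det (W W\<^sup>T)\<close>, and \<open>W W\<^sup>T\<close> is positive semidefinite of trace
  \<open>n + 1\<close>, so by Hadamard's inequality and AM-GM this sum is at most \<open>((n + 1) / n)\<^sup>n\<close>. To stay within
  square matrices, split \<open>W\<close> into an invertible matrix \<open>A\<close> and a last column \<open>A x\<close>: the minors
  are \<open>det A\<close> and, by Cramer's rule, \<open>x\<^sub>k det A\<close>, and \<open>W W\<^sup>T = A (I + x x\<^sup>T) A\<^sup>T\<close>.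
  For a regular simplex, a linear dependency among the \<open>w\<^sub>i\<close> forces all inner products to be
  \<open>- 1 / n\<close>, so each \<open>n\<close> of the vectors have Gram matrix \<open>(n + 1) / n (I - J / (n + 1))\<close>, where \<open>J\<close>
  is the all-ones matrix.
\<close>

section \<open>Hadamard's inequality\<close>

text \<open>In the induction the new row is replaced by its component orthogonal to the rows already
  treated. This subtracts a combination of other rows, so the determinant is kept, and by Pythagoras
  the norm does not grow.\<close>

lemma gram_schmidt_rows:
  fixes A :: "real ^ 'n ^ 'n"
  assumes "finite I"
  shows "\<exists>B. det B = det A \<and> (\<forall>i. norm (B $ i) \<le> norm (A $ i)) \<and>
    (\<forall>i\<in>I. \<forall>j\<in>I. i \<noteq> j \<longrightarrow> B $ i \<bullet> B $ j = 0)"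
  using assms
proof (induction I)
  case empty
  show ?case by (intro exI[of _ A]) simp
next
  case (insert i I)
  then obtain B where B: "det B = det A" "\<And>i. norm (B $ i) \<le> norm (A $ i)"
    "\<And>i j. i \<in> I \<Longrightarrow> j \<in> I \<Longrightarrow> i \<noteq> j \<Longrightarrow> B $ i \<bullet> B $ j = 0"
    by blast
  obtain y z where y: "y \<in> span (($) B ` I)"
    and z: "\<And>w. w \<in> span (($) B ` I) \<Longrightarrow> orthogonal z w" and yz: "B $ i = y + z"
    using orthogonal_subspace_decomp_exists by metis
  have z_orth: "z \<bullet> B $ j = 0" if "j \<in> I" for j
    using z[OF span_base] that by (simp add: orthogonal_def)
  have "(norm (B $ i))\<^sup>2 = (norm y)\<^sup>2 + (norm z)\<^sup>2"
    unfolding yz using norm_add_Pythagorean z[OF y] orthogonal_commute by blast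
  then have norm_z: "norm z \<le> norm (A $ i)"
    using B(2)[of i] power2_le_imp_le[of "norm z" "norm (B $ i)"] by simp
  define C where "C = (\<chi> k. if k = i then z else B $ k)"
  have row_B: "row k B = B $ k" for k
    by (simp add: row_def vec_eq_iff)
  have "($) B ` I \<subseteq> {row j B | j. j \<noteq> i}"
    using insert.hyps(2) by (auto simp: row_B)
  then have "- y \<in> span {row j B | j. j \<noteq> i}"
    using y span_mono span_neg by blast
  then have "det (\<chi> k. if k = i then row i B + - y else row k B) = det B"
    by (intro det_row_span) (simp add: span_vec_eq)
  then have "det C = det A"
    by (simp add: C_def row_B yz B(1) cong: if_cong)
  moreover have "norm (C $ k) \<le> norm (A $ k)" for k
    using B(2) norm_z by (simp add: C_def)
  moreover have "C $ k \<bullet> C $ l = 0" if "k \<in> insert i I" "l \<in> insert i I" "k \<noteq> l" for k l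
    using that B(3) z_orth by (auto simp: C_def inner_commute)
  ultimately show ?case by blast
qed

text \<open>Once the rows are orthogonal, \<open>B ** transpose B\<close> is diagonal with the
  squared row norms as entries, so equality holds for \<open>B\<close>.\<close>

theorem hadamard_inequality:
  fixes A :: "real ^ 'n ^ 'n"
  shows "\<bar>det A\<bar> \<le> (\<Prod>i\<in>UNIV. norm (A $ i))"
proof -
  obtain B where B: "det B = det A" "\<And>i. norm (B $ i) \<le> norm (A $ i)"
    "\<And>i j. i \<noteq> j \<Longrightarrow> B $ i \<bullet> B $ j = 0"
    using gram_schmidt_rows[of UNIV A] by auto
  have row_B: "row k B = B $ k" for k
    by (simp add: row_def vec_eq_iff)
  have "(det B)\<^sup>2 = det (B ** transpose B)"
    by (simp add: det_mul det_transpose power2_eq_square)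
  also have "\<dots> = (\<Prod>i\<in>UNIV. norm (B $ i))\<^sup>2"
    unfolding matrix_mult_transpose_dot_row
    by (subst det_diagonal) (simp_all add: row_B B(3) dot_square_norm prod_power_distrib)
  finally have "\<bar>det B\<bar> = (\<Prod>i\<in>UNIV. norm (B $ i))"
    by (simp add: power2_eq_iff abs_if prod_nonneg) (smt (verit) norm_ge_zero prod_nonneg)
  also have "\<dots> \<le> (\<Prod>i\<in>UNIV. norm (A $ i))"
    by (intro prod_mono) (simp add: B(2))
  finally show ?thesis by (simp add: B(1))
qed

section \<open>Determinant bound for a square matrix with one extra column\<close>

lemma prod_le_mean_power:
  fixes f :: "'a \<Rightarrow> real"
  assumes "finite S" "S \<noteq> {}" and nonneg: "\<And>i. i \<in> S \<Longrightarrow> f i \<ge> 0"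
  shows "prod f S \<le> (sum f S / card S) ^ card S"
proof -
  have pos: "card S > 0" using assms by (simp add: card_gt_0_iff)
  have P: "prod f S \<ge> 0" using nonneg by (intro prod_nonneg) auto
  have "prod f S = (prod f S powr (1 / card S)) ^ card S"
    using P pos by (cases "prod f S = 0") (simp_all add: powr_realpow[symmetric] powr_powr)
  also have "\<dots> \<le> (\<Sum>i\<in>S. f i / card S) ^ card S"
    using arith_geom_mean[OF assms] by (intro power_mono) auto
  finally show ?thesis by (simp add: sum_divide_distrib)
qed

text \<open>An orthogonal map \<open>f\<close> sending \<open>x\<close> to a multiple of a
  coordinate axis conjugates the matrix to a diagonal one in which a single entry differs from
  1.\<close>

lemma det_rank_one_update:
  fixes x :: "real ^ 'n"
  shows "det (\<chi> i j. (if i = j then 1 else 0) + t * x $ i * x $ j) = 1 + t * (norm x)\<^sup>2"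
proof -
  define M :: "real ^ 'n \<Rightarrow> real ^ 'n ^ 'n"
    where "M x = (\<chi> i j. (if i = j then 1 else 0) + t * x $ i * x $ j)" for x
  have M_vec: "M x *v u = u + (t * (x \<bullet> u)) *\<^sub>R x" for x u
  proof -
    have "(M x *v u) $ i
      = (\<Sum>j\<in>UNIV. (if i = j then u $ j else 0) + (t * x $ i) * (x $ j * u $ j))" for i
      unfolding M_def matrix_vector_mult_def by (simp, intro sum.cong) (auto simp: algebra_simps)
    then show ?thesis
      by (simp add: vec_eq_iff inner_vec_def sum.distrib flip: sum_distrib_left)
  qed
  fix k :: 'n
  let ?y = "norm x *\<^sub>R axis k 1 :: real ^ 'n"
  obtain f where f: "orthogonal_transformation f" "f x = ?y"
    by (rule orthogonal_transformation_exists[of x ?y]) simp_all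
  then have lin: "linear f" by (simp add: orthogonal_transformation_linear)
  have Q: "orthogonal_matrix (matrix f)" and mf: "matrix f *v u = f u" for u
    using f(1) by (simp_all add: orthogonal_transformation_matrix)
  have "matrix f ** M x = M ?y ** matrix f"
  proof -
    have "f (M x *v u) = M ?y *v f u" for u
    proof -
      have "?y \<bullet> f u = x \<bullet> u"
        using f by (metis orthogonal_transformation_def)
      then show ?thesis
        by (simp add: M_vec linear_add[OF lin] linear_scale[OF lin] f(2))
    qed
    then show ?thesis
      by (simp add: matrix_eq matrix_vector_mul_assoc[symmetric] mf)
  qed
  then have "det (matrix f) * det (M x) = det (M ?y) * det (matrix f)"
    by (metis det_mul)
  then have "det (M x) = det (M ?y)"
    using det_orthogonal_matrix[OF Q] by auto
  also have "\<dots> = (\<Prod>i\<in>UNIV. if i = k then 1 + t * (norm x)\<^sup>2 else 1)"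
  proof -
    have "M ?y $ i $ j = 0" if "i \<noteq> j" for i j
      using that by (auto simp: M_def axis_def)
    moreover have "M ?y $ i $ i = (if i = k then 1 + t * (norm x)\<^sup>2 else 1)" for i
      by (simp add: M_def axis_def power2_eq_square)
    ultimately show ?thesis
      by (simp add: det_diagonal)
  qed
  finally show ?thesis by (simp add: M_def)
qed

text \<open>The sum on the right is the trace of \<open>A (I + x x\<^sup>T) A\<^sup>T\<close>.
  Writing \<open>I + x x\<^sup>T\<close> as the square of a symmetric matrix \<open>C\<close> lets
  Hadamard and AM-GM apply to the rows of the square matrix \<open>A ** C\<close>.\<close>

lemma det_sq_rank_one_le:
  fixes A :: "real ^ 'n ^ 'n" and x :: "real ^ 'n"
  shows "(det A)\<^sup>2 * (1 + (norm x)\<^sup>2)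
    \<le> (((\<Sum>i\<in>UNIV. (norm (A $ i))\<^sup>2) + (norm (A *v x))\<^sup>2) / CARD('n)) ^ CARD('n)"
proof -
  \<comment> \<open>With this \<open>t\<close>, the matrix \<open>C = I + t x x\<^sup>T\<close> is the square root of \<open>I + x x\<^sup>T\<close>.\<close>
  define r where "r = sqrt (1 + (norm x)\<^sup>2)"
  define t where "t = 1 / (1 + r)"
  have r: "r \<ge> 0" "r\<^sup>2 = 1 + (norm x)\<^sup>2"
    by (simp_all add: r_def)
  have tr: "t * (norm x)\<^sup>2 = r - 1"
  proof -
    have "(norm x)\<^sup>2 = (r - 1) * (1 + r)"
      using r(2) by (simp add: algebra_simps power2_eq_square)
    then show ?thesis using r(1) by (simp add: t_def)
  qed
  \<comment> \<open>The left side is the coefficient of \<open>x x\<^sup>T\<close> in the square of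
    \<open>I + t x x\<^sup>T\<close>.\<close>
  have t: "2 * t + t\<^sup>2 * (norm x)\<^sup>2 = 1"
  proof -
    have "2 * t + t\<^sup>2 * (norm x)\<^sup>2 = t * (2 + t * (norm x)\<^sup>2)"
      by (simp add: algebra_simps power2_eq_square)
    then show ?thesis using r(1) tr by (simp add: t_def)
  qed
  define C :: "real ^ 'n ^ 'n"
    where "C = (\<chi> i j. (if i = j then 1 else 0) + t * x $ i * x $ j)"
  have det_C: "(det C)\<^sup>2 = 1 + (norm x)\<^sup>2"
    unfolding C_def det_rank_one_update tr using r by simp
  have row: "(A ** C) $ i = A $ i + (t * (A $ i \<bullet> x)) *\<^sub>R x" for i
  proof -
    have "(A ** C) $ i $ j
      = (\<Sum>k\<in>UNIV. (if k = j then A $ i $ k else 0) + (t * x $ j) * (A $ i $ k * x $ k))" for j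
      unfolding C_def matrix_matrix_mult_def by (simp, intro sum.cong) (auto simp: algebra_simps)
    then show ?thesis
      by (simp add: vec_eq_iff inner_vec_def sum.distrib flip: sum_distrib_left)
  qed
  \<comment> \<open>This is the squared norm of row \<open>i\<close> of \<open>A\<close> extended by
    the column \<open>A *v x\<close>.\<close>
  have norm_row: "(norm ((A ** C) $ i))\<^sup>2 = (norm (A $ i))\<^sup>2 + ((A *v x) $ i)\<^sup>2" for i
  proof -
    have "(norm ((A ** C) $ i))\<^sup>2
      = (norm (A $ i))\<^sup>2 + (2 * t + t\<^sup>2 * (norm x)\<^sup>2) * (A $ i \<bullet> x)\<^sup>2"
      unfolding row power2_norm_eq_inner
      by (simp add: inner_add inner_commute algebra_simps power2_eq_square)
    then show ?thesis
      by (simp add: t matrix_vector_mul_component)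
  qed
  have "(det A)\<^sup>2 * (1 + (norm x)\<^sup>2) = \<bar>det (A ** C)\<bar>\<^sup>2"
    by (simp add: det_mul power_mult_distrib det_C)
  also have "\<dots> \<le> (\<Prod>i\<in>UNIV. norm ((A ** C) $ i))\<^sup>2"
    by (intro power_mono hadamard_inequality) simp
  also have "\<dots> = (\<Prod>i\<in>UNIV. (norm ((A ** C) $ i))\<^sup>2)"
    by (simp add: prod_power_distrib)
  also have "\<dots> \<le> ((\<Sum>i\<in>UNIV. (norm ((A ** C) $ i))\<^sup>2) / CARD('n)) ^ CARD('n)"
    by (rule prod_le_mean_power) auto
  also have "(\<Sum>i\<in>UNIV. (norm ((A ** C) $ i))\<^sup>2)
    = (\<Sum>i\<in>UNIV. (norm (A $ i))\<^sup>2) + (norm (A *v x))\<^sup>2"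
    unfolding norm_row sum.distrib power2_norm_eq_inner[of "A *v x"]
    by (simp add: inner_vec_def power2_eq_square)
  finally show ?thesis .
qed

text \<open>Both sides are the squared Frobenius norm; this brings the unit length of the columns
  into the row sum of \<open>det_sq_rank_one_le\<close>.\<close>

lemma sum_norm_rows_eq_columns:
  fixes w :: "'m::finite \<Rightarrow> real ^ 'n"
  shows "(\<Sum>i\<in>UNIV. (norm ((\<chi> i k. w k $ i) $ i :: real ^ 'm))\<^sup>2) = (\<Sum>k\<in>UNIV. (norm (w k))\<^sup>2)"
  unfolding power2_norm_eq_inner inner_vec_def by (simp, rule sum.swap)

section \<open>Upper bound for the minimal determinant\<close>

text \<open>Indexing all but one vector by the coordinate type makes them the columns of a square
  matrix.\<close>

lemma exists_inj_range_card_Suc: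
  fixes V :: "'a set"
  assumes "card V = CARD('n::finite) + 1"
  obtains w :: "'n::finite \<Rightarrow> 'a" and v where "inj w" "v \<notin> range w" "V = insert v (range w)"
proof -
  have fin: "finite V" using assms card.infinite by fastforce
  obtain v where v: "v \<in> V" using assms by fastforce
  have "card (UNIV :: 'n set) = card (V - {v})" using assms v fin by simp
  then obtain w :: "'n \<Rightarrow> 'a" where "bij_betw w UNIV (V - {v})"
    using fin finite_same_card_bij by (metis finite finite_Diff)
  then have w: "inj w" "range w = V - {v}"
    by (simp_all add: bij_betw_def)
  show thesis
  proof (rule that)
    show "inj w" by (rule w(1))
    show "v \<notin> range w" by (simp add: w(2))
    show "V = insert v (range w)" using v by (simp add: w(2) insert_absorb)
  qed
qed

context
  fixes V :: "(real ^ 'n) set"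
  assumes card_V: "card V = CARD('n) + 1"
begin

lemma finite_abs_dets:
  "finite {\<bar>det (\<chi> i k. w k $ i)\<bar> | w :: 'n \<Rightarrow> real ^ 'n. inj w \<and> range w \<subseteq> V}"
proof -
  have "finite V" using card_V card.infinite by fastforce
  then have "finite (PiE (UNIV :: 'n set) (\<lambda>_. V))" by (intro finite_PiE) auto
  then have "finite {w :: 'n \<Rightarrow> real ^ 'n. inj w \<and> range w \<subseteq> V}"
    by (rule finite_subset[rotated]) (auto simp: PiE_def)
  then show ?thesis by (simp add: setcompr_eq_image)
qed

lemma min_abs_det_le:
  fixes w :: "'n \<Rightarrow> real ^ 'n"
  assumes "inj w" "range w \<subseteq> V"
  shows "min_abs_det V \<le> \<bar>det (\<chi> i k. w k $ i)\<bar>"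
  unfolding min_abs_det_def using assms by (intro Min_le finite_abs_dets) blast

lemma min_abs_det_in:
  obtains w :: "'n \<Rightarrow> real ^ 'n"
  where "inj w" "range w \<subseteq> V" "min_abs_det V = \<bar>det (\<chi> i k. w k $ i)\<bar>"
proof -
  obtain w :: "'n \<Rightarrow> real ^ 'n" and v where "inj w" "V = insert v (range w)"
    using exists_inj_range_card_Suc[OF card_V] by metis
  then have "{\<bar>det (\<chi> i k. w k $ i)\<bar> | w :: 'n \<Rightarrow> real ^ 'n. inj w \<and> range w \<subseteq> V} \<noteq> {}"
    by blast
  from Min_in[OF finite_abs_dets this] show thesis
    unfolding min_abs_det_def[symmetric] using that by blast
qed

text \<open>Each of the \<open>n + 1\<close> squared minors is at least the squared minimum, so
  their sum is at least \<open>n + 1\<close> times it.\<close>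

lemma card_mult_min_abs_det_sq_le:
  assumes unit: "\<And>v. v \<in> V \<Longrightarrow> norm v = 1"
  shows "(CARD('n) + 1) * (min_abs_det V)\<^sup>2 \<le> ((CARD('n) + 1) / CARD('n)) ^ CARD('n)"
proof (cases "min_abs_det V = 0")
  case True
  then show ?thesis by simp
next
  case False
  obtain w :: "'n \<Rightarrow> real ^ 'n" and v
    where w: "inj w" "v \<notin> range w" and V: "V = insert v (range w)"
    using exists_inj_range_card_Suc[OF card_V] by metis
  define A where "A = (\<chi> i k. w k $ i)"
  let ?D = "min_abs_det V"
  have D_nonneg: "?D \<ge> 0"
    by (rule min_abs_det_in) simp
  have D_A: "?D \<le> \<bar>det A\<bar>"
    unfolding A_def by (rule min_abs_det_le) (use w V in auto)
  \<comment> \<open>A nonzero minimum makes \<open>A\<close> invertible, so the remaining vector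
    \<open>v\<close> can be written as \<open>A *v x\<close>.\<close>
  then have "det A \<noteq> 0" using False D_nonneg by auto
  then obtain x where x: "A *v x = v"
    using cramer by blast
  have D_x: "?D \<le> \<bar>x $ k * det A\<bar>" for k
  proof -
    have "?D \<le> \<bar>det (\<chi> i j. (w(k := v)) j $ i)\<bar>"
    proof (rule min_abs_det_le)
      show "inj (w(k := v))" using w by (auto simp: inj_def)
    qed (use V in auto)
    also have "(\<chi> i j. (w(k := v)) j $ i) = (\<chi> i j. if j = k then (A *v x) $ i else A $ i $ j)"
      unfolding x by (simp add: A_def vec_eq_iff)
    finally show ?thesis by (simp add: cramer_lemma)
  qed
  have "(CARD('n) + 1) * ?D\<^sup>2 = ?D\<^sup>2 + (\<Sum>k\<in>(UNIV::'n set). ?D\<^sup>2)"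
    by (simp add: algebra_simps)
  also have "\<dots> \<le> \<bar>det A\<bar>\<^sup>2 + (\<Sum>k\<in>UNIV. \<bar>x $ k * det A\<bar>\<^sup>2)"
    using D_A D_x D_nonneg by (intro add_mono sum_mono power_mono)
  also have "\<dots> = (det A)\<^sup>2 * (1 + (norm x)\<^sup>2)"
    unfolding power2_norm_eq_inner inner_vec_def
    by (simp add: sum_distrib_left algebra_simps power2_eq_square)
  also have "\<dots> \<le> (((\<Sum>i\<in>UNIV. (norm (A $ i))\<^sup>2) + (norm (A *v x))\<^sup>2) / CARD('n)) ^ CARD('n)"
    by (rule det_sq_rank_one_le)
  also have "(\<Sum>i\<in>UNIV. (norm (A $ i))\<^sup>2) = CARD('n)"
    unfolding A_def sum_norm_rows_eq_columns using V unit by simp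
  also have "norm (A *v x) = 1"
    using x V unit by simp
  finally show ?thesis by (simp add: add.commute)
qed

section \<open>The regular simplex\<close>

text \<open>Unit length and equal distances give one common inner product \<open>r\<close>. Pairing
  a linear dependency with each vector shows that all its coefficients agree, which forces
  \<open>1 + n r = 0\<close>.\<close>

lemma simplex_inner:
  assumes unit: "\<And>v. v \<in> V \<Longrightarrow> norm v = 1"
    and dist: "\<And>p q. p \<in> V \<Longrightarrow> q \<in> V \<Longrightarrow> p \<noteq> q \<Longrightarrow> dist p q = d"
    and "p \<in> V" "q \<in> V" "p \<noteq> q"
  shows "p \<bullet> q = - 1 / CARD('n)"
proof -
  have fin: "finite V" using card_V card.infinite by fastforce
  define r where "r = 1 - d\<^sup>2 / 2"
  have inner: "p \<bullet> q = r" if "p \<in> V" "q \<in> V" "p \<noteq> q" for p q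
  proof -
    have "p \<bullet> p = 1" "q \<bullet> q = 1"
      using unit that by (simp_all add: dot_square_norm)
    then have "d\<^sup>2 = 2 - 2 * (p \<bullet> q)"
      using dist[OF that, symmetric]
      by (simp add: dist_norm power2_norm_eq_inner inner_diff inner_commute)
    then show ?thesis by (simp add: r_def field_simps)
  qed
  \<comment> \<open>\<open>1 - r\<close> must be nonzero so that it can be cancelled when
    coefficients are compared.\<close>
  have "d \<noteq> 0" using dist assms(3-5) by (metis dist_eq_0_iff)
  then have r: "1 - r \<noteq> 0" by (simp add: r_def)
  have "dependent V"
    using card_V fin by (intro dependent_biggerset) auto
  then obtain c u where u: "u \<in> V" "c u \<noteq> 0" and c: "(\<Sum>v\<in>V. c v *\<^sub>R v) = 0"
    using dependent_finite[OF fin] by auto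
  have cv: "(1 - r) * c v + r * sum c V = 0" if "v \<in> V" for v
  proof -
    have "0 = v \<bullet> (\<Sum>v\<in>V. c v *\<^sub>R v)" by (simp add: c)
    also have "\<dots> = (\<Sum>u\<in>V. c u * (v \<bullet> u))" by (simp add: inner_sum_right)
    also have "\<dots> = c v + (\<Sum>u\<in>V - {v}. c u * r)"
    proof -
      have "(\<Sum>u\<in>V - {v}. c u * (v \<bullet> u)) = (\<Sum>u\<in>V - {v}. c u * r)"
        using inner[OF that] by (intro sum.cong) auto
      then show ?thesis
        using that fin unit[OF that] by (simp add: sum.remove[of V v] dot_square_norm)
    qed
    also have "\<dots> = c v + r * (sum c V - c v)"
      using that fin by (simp add: sum_distrib_left[symmetric] sum_diff1 mult.commute
          flip: sum_distrib_right)
    finally show ?thesis by (simp add: algebra_simps)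
  qed
  have "c v = c u" if "v \<in> V" for v
  proof -
    have "(1 - r) * c v = (1 - r) * c u"
      using cv[OF that] cv[OF u(1)] by linarith
    then show ?thesis using r by simp
  qed
  then have "sum c V = (CARD('n) + 1) * c u"
    by (simp add: card_V)
  with cv[OF u(1)] have "(1 + r * CARD('n)) * c u = 0"
    by (simp add: algebra_simps)
  then have "r * CARD('n) = - 1" using u by simp
  then show ?thesis
    using inner[OF assms(3-5)] by (simp add: field_simps)
qed

end

text \<open>The squared determinant is the Gram determinant. Taking \<open>(n + 1) / n\<close> out
  of every row leaves a rank-one update of the identity.\<close>

lemma det_sq_regular_simplex:
  fixes w :: "'n \<Rightarrow> real ^ 'n"
  assumes unit: "\<And>i. norm (w i) = 1"
    and inner: "\<And>i j. i \<noteq> j \<Longrightarrow> w i \<bullet> w j = - 1 / CARD('n)"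
  shows "(CARD('n) + 1) * (det (\<chi> i k. w k $ i))\<^sup>2 = ((CARD('n) + 1) / CARD('n)) ^ CARD('n)"
proof -
  let ?n = "real CARD('n)" and ?A = "\<chi> i k. w k $ i"
  \<comment> \<open>Here \<open>1\<close> is the all-ones vector, of squared norm \<open>n\<close>;
    with \<open>t = - 1 / (n + 1)\<close> the determinant is \<open>1 - n / (n + 1)\<close>.\<close>
  let ?B = "(\<chi> i j. (if i = j then 1 else 0) + (- 1 / (?n + 1)) * (1 :: real ^ 'n) $ i * 1 $ j)
    :: real ^ 'n ^ 'n"
  have col: "column k ?A = w k" for k
    by (simp add: column_def vec_eq_iff)
  have gram: "transpose ?A ** ?A = (\<chi> i. ((?n + 1) / ?n) *s (?B $ i))"
  proof -
    have "w i \<bullet> w j = ((?n + 1) / ?n) * ((if i = j then 1 else 0) - 1 / (?n + 1))" for i j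
    proof (cases "i = j")
      case True
      have "(x + 1) / x * (1 - 1 / (x + 1)) = 1" if "x > 0" for x :: real
        using that by (simp add: diff_divide_distrib[symmetric] divide_simps)
      then have "((?n + 1) / ?n) * (1 - 1 / (?n + 1)) = 1"
        by simp
      then show ?thesis using True by (simp add: dot_square_norm unit)
    next
      case False
      have "?n + 1 \<noteq> 0" by (metis of_nat_Suc of_nat_neq_0 add.commute)
      then show ?thesis using False by (simp add: inner field_simps)
    qed
    then show ?thesis
      unfolding matrix_mult_transpose_dot_column col by (simp add: vec_eq_iff)
  qed
  have "(det ?A)\<^sup>2 = det (transpose ?A ** ?A)"
    by (simp only: det_mul det_transpose power2_eq_square)
  also have "\<dots> = det (\<chi> i. ((?n + 1) / ?n) *s (?B $ i))"
    by (simp only: gram)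
  also have "\<dots> = ((?n + 1) / ?n) ^ CARD('n) * det ?B"
    by (subst det_rows_mul) simp
  also have "det ?B = 1 / (?n + 1)"
    unfolding det_rank_one_update by (simp add: power2_norm_eq_inner inner_vec_def field_simps)
  finally have "(det ?A)\<^sup>2 = ((?n + 1) / ?n) ^ CARD('n) / (?n + 1)" by simp
  moreover have "?n + 1 \<noteq> 0" by (metis of_nat_Suc of_nat_neq_0 add.commute)
  ultimately have "(?n + 1) * (det ?A)\<^sup>2 = ((?n + 1) / ?n) ^ CARD('n)"
    by (metis nonzero_mult_div_cancel_left times_divide_eq_right)
  then show ?thesis by (simp add: add.commute)
qed

lemma simplex_bound_eq:
  assumes "n > 0"
  shows "((real n + 1) / n) ^ n / (real n + 1) = (real n + 1) ^ (n - 1) / real n ^ n"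
  using assms by (cases n) (simp_all add: power_divide)

theorem corollary14:
  fixes V :: "(real ^ 'n) set"
  assumes "card V = CARD('n) + 1"
    and "\<forall>v\<in>V. norm v = 1"
  shows "min_abs_det V \<le> sqrt ((real CARD('n) + 1) ^ (CARD('n) - 1) / real CARD('n) ^ CARD('n))
    \<and> ((\<exists>S. regular_simplex_with_vertices S V) \<longrightarrow>
        min_abs_det V = sqrt ((real CARD('n) + 1) ^ (CARD('n) - 1) / real CARD('n) ^ CARD('n)))"
proof -
  let ?n = "CARD('n)"
  have bound: "(real ?n + 1) ^ (?n - 1) / real ?n ^ ?n = ((real ?n + 1) / ?n) ^ ?n / (real ?n + 1)"
    by (rule simplex_bound_eq[symmetric]) simp
  have "(min_abs_det V)\<^sup>2 \<le> ((real ?n + 1) / ?n) ^ ?n / (real ?n + 1)"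
    using card_mult_min_abs_det_sq_le[OF assms(1)] assms(2)
    by (simp add: pos_le_divide_eq mult.commute add.commute)
  then have "min_abs_det V \<le> sqrt (((real ?n + 1) / ?n) ^ ?n / (real ?n + 1))"
    by (rule real_le_rsqrt)
  moreover have "min_abs_det V = sqrt (((real ?n + 1) / ?n) ^ ?n / (real ?n + 1))"
    if simplex: "regular_simplex_with_vertices S V" for S
  proof -
    obtain d where "\<forall>p\<in>V. \<forall>q\<in>V. p \<noteq> q \<longrightarrow> dist p q = d"
      using simplex by (auto simp: regular_simplex_with_vertices_def)
    then have d: "dist p q = d" if "p \<in> V" "q \<in> V" "p \<noteq> q" for p q
      using that by blast
    \<comment> \<open>All choices of \<open>n\<close> vertices give the same absolute determinant,
      so it is enough to evaluate one that attains the minimum.\<close>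
    obtain w :: "'n \<Rightarrow> real ^ 'n"
      where w: "inj w" "range w \<subseteq> V" and D: "min_abs_det V = \<bar>det (\<chi> i k. w k $ i)\<bar>"
      using min_abs_det_in[OF assms(1)] .
    have "(?n + 1) * (det (\<chi> i k. w k $ i))\<^sup>2 = ((?n + 1) / ?n) ^ ?n"
    proof (rule det_sq_regular_simplex)
      show "norm (w i) = 1" for i using w assms(2) by auto
      show "w i \<bullet> w j = - 1 / ?n" if "i \<noteq> j" for i j
        using w that assms(2) by (intro simplex_inner[OF assms(1) _ d]) (auto dest: injD)
    qed
    then have "(min_abs_det V)\<^sup>2 = ((real ?n + 1) / ?n) ^ ?n / (real ?n + 1)"
      by (simp add: D eq_divide_eq mult.commute add.commute)
    then show ?thesis
      by (intro real_sqrt_unique[symmetric]) (simp_all add: D)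
  qed
  ultimately show ?thesis unfolding bound by blast
qed

end
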